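(* For every integer $n\ge 0$, the following identity of polynomials in $x$ holds: \[ B_{n}(x)=\sum_{k=0}^{n}\left( \left(2^{k+2}k+2^{k+1}\right)\sum_{\substack{0\le j\le n\\ j-k\equiv 0 \pmod 2}}\frac{j!\binom{n}{j}\left(\frac{j+k+2}{2}\right)!}{\left(\frac{j-k}{2}\right)!\,(j+k+2)!}\,B_{n-j}\right)P_{k}(x). \]
   Context: $P_k(x)$ denotes the $k$-th Legendre polynomial, defined by $\frac{1}{\sqrt{1-2xt+t^2}}=\sum_{k\ge 0}P_k(x)t^k$ (equivalently $P_k(x)=\frac{1}{k!2^k}\frac{d^k}{dx^k}(x^2-1)^k$). The Bernoulli polynomials $B_n(x)$ are defined by $\frac{t}{e^t-1}e^{xt}=\sum_{n\ge0}B_n(x)\frac{t^n}{n!}$, and $B_m:=B_m(0)$ denotes the $m$-th Bernoulli number. Convention: terms in the inner sum with $j<k$ (where $\frac{j-k}{2}$ is a negative integer) are taken to be $0$, i.e. $1/m!=0$ for negative integers $m$. *)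

theory Defs
  imports Complex_Main "HOL-Computational_Algebra.Computational_Algebra"
begin

text \<open>
  Generating functions in a parameter \<open>x\<close> are elements of \<open>real poly fps\<close>: power series in
  \<open>t\<close> (= \<^const>\<open>fps_X\<close>) whose coefficients are polynomials in \<open>x\<close> (= \<open>[:0, 1:]\<close>).
\<close>

text \<open>A power series with constant coefficients, regarded as one that does not involve \<open>x\<close>.\<close>

definition fps_lift :: "real fps \<Rightarrow> real poly fps" where
  "fps_lift F = Abs_fps (\<lambda>n. [:fps_nth F n:])"

text \<open>
  \<open>1 / sqrt (1 - 2xt + t\<^sup>2)\<close> is the binomial series \<open>(1 + u) powr (-1/2)\<close> at
  \<open>u = -2xt + t\<^sup>2\<close>, which has zero constant term.
\<close>

definition legendre_gf :: "real poly fps" where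
  "legendre_gf =
     fps_lift (fps_binomial (- 1 / 2)) oo (fps_X ^ 2 - fps_const [:0, 2:] * fps_X)"

definition legendre_poly :: "nat \<Rightarrow> real poly" where
  "legendre_poly k = fps_nth legendre_gf k"

text \<open>
  \<open>t / (exp t - 1) * exp (xt)\<close>. The quotient of \<^typ>\<open>real fps\<close> is the genuine one, as both series
  have order one in \<open>t\<close>.
\<close>

definition bernoulli_gf :: "real poly fps" where
  "bernoulli_gf =
     fps_lift (fps_X / (fps_exp 1 - 1)) * Abs_fps (\<lambda>n. smult (1 / fact n) ([:0, 1:] ^ n))"

definition bernoulli_poly :: "nat \<Rightarrow> real poly" where
  "bernoulli_poly n = smult (fact n) (fps_nth bernoulli_gf n)"

definition bernoulli_number :: "nat \<Rightarrow> real" where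
  "bernoulli_number n = poly (bernoulli_poly n) 0"

definition inv_fact :: "int \<Rightarrow> real" where
  "inv_fact m = (if m < 0 then 0 else 1 / fact (nat m))"

text \<open>The generating functions satisfy the equations that characterise them.\<close>

lemma fps_lift_mult: "fps_lift (F * G) = fps_lift F * fps_lift G"
proof (rule fps_ext)
  fix n
  have sum_const: "(\<Sum>i\<in>A. [:f i:]) = [:sum f A:]" for f :: "nat \<Rightarrow> real" and A
    by (induction A rule: infinite_finite_induct) auto
  show "fps_nth (fps_lift (F * G)) n = fps_nth (fps_lift F * fps_lift G) n"
    by (simp add: fps_lift_def fps_mult_nth sum_const mult.commute)
qed

lemma legendre_gf_square:
  "legendre_gf ^ 2 * (1 - fps_const [:0, 2:] * fps_X + fps_X ^ 2) = 1"
proof -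
  define u :: "real poly fps" where "u = fps_X ^ 2 - fps_const [:0, 2:] * fps_X"
  have u0: "fps_nth u 0 = 0"
    by (simp add: u_def)
  have one: "fps_lift 1 = 1"
    by (rule fps_ext) (simp add: fps_lift_def one_pCons)
  have lin: "fps_lift (1 + fps_X) = 1 + fps_X"
    by (rule fps_ext) (auto simp: fps_lift_def fps_X_def one_pCons)
  have "fps_binomial (-1/2) * fps_binomial (-1/2) * (1 + fps_X) = (1 :: real fps)"
    by (simp add: fps_binomial_add_mult [symmetric] fps_binomial_minus_one inverse_mult_eq_1)
  then have "fps_lift (fps_binomial (-1/2)) * fps_lift (fps_binomial (-1/2)) * (1 + fps_X) = 1"
    by (metis fps_lift_mult one lin)
  then have "(fps_lift (fps_binomial (-1/2)) * fps_lift (fps_binomial (-1/2)) * (1 + fps_X)) oo u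
      = 1 oo u"
    by simp
  then have "legendre_gf * legendre_gf * (1 + u) = 1"
    by (simp add: fps_compose_mult_distrib [OF u0] fps_compose_add_distrib u0
        legendre_gf_def flip: u_def)
  then show ?thesis
    by (simp add: u_def power2_eq_square algebra_simps)
qed

lemma legendre_poly_0: "legendre_poly 0 = 1"
  by (simp add: legendre_poly_def legendre_gf_def fps_lift_def one_pCons)

lemma bernoulli_gf_mult:
  "fps_lift (fps_exp 1 - 1) * bernoulli_gf =
     fps_X * Abs_fps (\<lambda>n. smult (1 / fact n) ([:0, 1:] ^ n))"
proof -
  have "subdegree (fps_exp 1 - 1 :: real fps) = 1"
    by (rule subdegreeI) auto
  then have "(fps_exp 1 - 1 :: real fps) dvd fps_X"
    by (subst fps_dvd_iff) auto
  then have "(fps_exp 1 - 1 :: real fps) * (fps_X / (fps_exp 1 - 1)) = fps_X"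
    by simp
  moreover have "fps_lift fps_X = fps_X"
    by (rule fps_ext) (auto simp: fps_lift_def fps_X_def one_pCons)
  ultimately have "fps_lift (fps_exp 1 - 1) * fps_lift (fps_X / (fps_exp 1 - 1)) = fps_X"
    by (metis fps_lift_mult)
  then show ?thesis
    by (simp add: bernoulli_gf_def flip: mult.assoc)
qed

end

theory Submission
  imports Defs
begin

text \<open>
  Since the Bernoulli polynomials are \<open>\<Sum>j. (n choose j) B\<^bsub>n-j\<^esub> x ^ j\<close>, everything reduces to the Legendre
  expansion of the powers \<open>x ^ j\<close>. Differentiating the generating function gives Bonnet's recurrence
  \<open>(2k + 1) x P\<^bsub>k\<^esub> = (k + 1) P\<^bsub>k+1\<^esub> + k P\<^bsub>k-1\<^esub>\<close>, and the expansion follows by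
  induction on \<open>j\<close> because its coefficients satisfy the adjoint recurrence.
\<close>

text \<open>Differentiate \<open>legendre_gf_square\<close>: the quadratic factor has derivative
  \<open>-2 (x - t)\<close>. Since the power series form an integral domain, the nonzero factor
  \<open>2 * legendre_gf\<close> cancels.\<close>

lemma legendre_gf_deriv:
  "fps_deriv legendre_gf * (1 - fps_const [:0, 2:] * fps_X + fps_X ^ 2)
     = legendre_gf * (fps_const [:0, 1:] - fps_X)"
proof -
  let ?G = legendre_gf and ?x = "fps_const [:0, 1:] :: real poly fps"
  have x2: "fps_const [:0, 2:] = 2 * ?x"
    by (simp add: numeral_fps_const numeral_poly flip: fps_const_mult)
  have D: "fps_deriv (1 - fps_const [:0, 2:] * fps_X + fps_X ^ 2 :: real poly fps)
      = - 2 * (?x - fps_X)"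
    by (simp add: x2 power2_eq_square algebra_simps)
  have "fps_deriv (?G ^ 2 * (1 - fps_const [:0, 2:] * fps_X + fps_X ^ 2)) = 0"
    by (simp add: legendre_gf_square)
  then have "2 * ?G * (fps_deriv ?G * (1 - fps_const [:0, 2:] * fps_X + fps_X ^ 2)
      - ?G * (?x - fps_X)) = 0"
    unfolding fps_deriv_mult D by (simp add: power2_eq_square algebra_simps)
  moreover have "?G \<noteq> 0"
    using legendre_gf_square by force
  ultimately show ?thesis
    by simp
qed

lemma legendre_poly_1: "legendre_poly 1 = [:0, 1:]"
  using arg_cong [OF legendre_gf_deriv, of "\<lambda>F. fps_nth F 0"]
  by (simp add: legendre_poly_0 [unfolded legendre_poly_def] legendre_poly_def)

text \<open>Compares coefficients of \<open>t ^ k\<close> in \<open>legendre_gf_deriv\<close>. At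
  \<open>k = 0\<close> the truncated index \<open>k - 1\<close> is harmless, as its factor is
  0.\<close>

lemma legendre_poly_bonnet:
  "smult (2 * real k + 1) ([:0, 1:] * legendre_poly k) =
     smult (real (k + 1)) (legendre_poly (k + 1)) + smult (real k) (legendre_poly (k - 1))"
proof (cases k)
  case 0
  then show ?thesis
    by (simp add: legendre_poly_0 legendre_poly_1 [simplified])
next
  case (Suc m)
  have x2: "[:0, 2:] = (2 :: real poly) * [:0, 1:]"
    by (simp add: numeral_poly)
  have [simp]: "fps_nth (F * (fps_const c * fps_X)) (Suc i) = c * fps_nth F i"
      "fps_nth (F * (fps_const c * fps_X)) 0 = 0"
    for F :: "real poly fps" and c i
    by (simp_all add: mult.left_commute [of F])
  have "fps_nth (fps_deriv legendre_gf * (1 - fps_const [:0, 2:] * fps_X + fps_X ^ 2)) (Suc m)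
      = fps_nth (legendre_gf * (fps_const [:0, 1:] - fps_X)) (Suc m)"
    by (simp only: legendre_gf_deriv)
  then have "of_nat (m + 2) * legendre_poly (m + 2)
        - [:0, 2:] * (of_nat (m + 1) * legendre_poly (m + 1)) + of_nat m * legendre_poly m
      = [:0, 1:] * legendre_poly (m + 1) - legendre_poly m"
    \<comment> \<open>The \<open>fps_X ^ 2\<close> term contributes the coefficient of the
      derivative at \<open>m - 1\<close>, namely \<open>m * legendre_poly m\<close>; for
      \<open>m = 0\<close> it contributes nothing.\<close>
    by (cases m) (simp_all add: legendre_poly_def distrib_left right_diff_distrib
        fps_X_power_mult_right_nth mult.commute [of _ "[:0, 1:]"])
  then have "(2 * of_nat k + 1) * ([:0, 1:] * legendre_poly k)
      = of_nat (k + 1) * legendre_poly (k + 1) + of_nat k * legendre_poly (k - 1)"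
    by (simp add: Suc x2 algebra_simps del: mult_pCons_left mult_pCons_right)
  moreover have "smult (real i) p = of_nat i * p" for i p
    by (simp add: of_nat_poly)
  moreover have "smult (2 * real i + 1) p = (2 * of_nat i + 1) * p" for i p
    by (simp add: of_nat_poly numeral_poly one_pCons mult.commute)
  ultimately show ?thesis
    by (simp only:)
qed

text \<open>Closed form of half the integral of \<open>x ^ j * P_k\<close> over [-1, 1]. The
  normalising factor \<open>2 * k + 1\<close> is kept outside.\<close>

definition power_legendre_coeff :: "nat \<Rightarrow> nat \<Rightarrow> real" where
  "power_legendre_coeff j k =
     (if even (int j - int k)
      then 2 ^ (k + 1) * fact j * fact ((j + k + 2) div 2) * inv_fact ((int j - int k) div 2)
        / fact (j + k + 2)
      else 0)"

text \<open>Holds for every integer because \<open>inv_fact\<close> vanishes on negatives: at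
  \<open>m = 0\<close> the factor \<open>m\<close> kills the right side too. This avoids a case
  split at the diagonal \<open>j = k\<close> later.\<close>

lemma inv_fact_minus_one: "inv_fact (m - 1) = of_int m * inv_fact m"
proof (cases "m \<le> 0")
  case True
  then show ?thesis by (auto simp: inv_fact_def)
next
  case False
  then obtain i where "m = int (Suc i)"
    by (metis not_le zero_less_imp_eq_int not0_implies_Suc less_numeral_extra(3))
  moreover have "fact i + fact i * real i > 0"
    by (simp add: add_pos_nonneg)
  ultimately show ?thesis
    by (simp add: inv_fact_def nat_add_distrib field_simps)
qed

lemma power_legendre_coeff_zero: "j < k \<Longrightarrow> power_legendre_coeff j k = 0"
  by (auto simp: power_legendre_coeff_def inv_fact_def)

text \<open>All three coefficients are multiples of one quantity \<open>F\<close>; with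
  \<open>M = (j+1+k)/2\<close> and \<open>S = (j+1-k)/2\<close>, a polynomial identity in
  \<open>M\<close> and \<open>S\<close> remains.\<close>

lemma power_legendre_coeff_Suc:
  "(2 * real k + 1) * power_legendre_coeff (Suc j) k =
     real k * power_legendre_coeff j (k - 1) + real (k + 1) * power_legendre_coeff j (k + 1)"
proof (cases "even (j + 1 + k)")
  case False
  then show ?thesis
    by (cases k) (auto simp: power_legendre_coeff_def)
next
  case True
  then obtain M where M: "j + 1 + k = 2 * M" by (elim evenE)
  define S where "S = int M - int k"
  have S: "int (Suc j) - int k = 2 * S" "int j - int (k + 1) = 2 * (S - 1)"
    using M by (auto simp: S_def)
  define F where "F = 2 ^ k * fact j * fact M * inv_fact S / fact (2 * M + 2)"
  have rk: "real k = real M - of_int S" and rj: "real j + 1 = real M + of_int S"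
    using S by (auto simp: S_def)
  have Suc_eq: "Suc j + k + 2 = 2 * M + 2" "j + (k + 1) + 2 = 2 * M + 2"
    using M by auto
  have [simp]: "(2 * M + 2) div 2 = Suc M" by simp
  have fj: "fact (Suc j) = (real M + of_int S) * fact j"
    by (simp flip: rj)
  have 1: "power_legendre_coeff (Suc j) k = 2 * (real M + of_int S) * (real M + 1) * F"
    unfolding power_legendre_coeff_def S Suc_eq F_def fj by (simp add: add.commute)
  have 2: "power_legendre_coeff j (k + 1) = 4 * (real M + 1) * of_int S * F"
    unfolding power_legendre_coeff_def S Suc_eq F_def
    by (simp add: inv_fact_minus_one add.commute)
  \<comment> \<open>The factor \<open>real k\<close> must stay: at \<open>k = 0\<close> the index
    \<open>k - 1\<close> truncates to 0, which has the wrong parity.\<close>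
  have 3: "real k * power_legendre_coeff j (k - 1)
      = real k * ((2 * real M + 2) * (2 * real M + 1) * F)"
  proof (cases k)
    case (Suc i)
    have e: "int j - int i = 2 * S" "j + i + 2 = 2 * M"
      using S Suc M by auto
    have f: "fact (2 * M + 2) = (2 * real M + 2) * (2 * real M + 1) * fact (2 * M)"
      by (simp add: algebra_simps)
    have "power_legendre_coeff j i = (2 * real M + 2) * (2 * real M + 1) * F"
      unfolding power_legendre_coeff_def e F_def f Suc by simp
    then show ?thesis by (simp add: Suc)
  qed simp
  show ?thesis
    unfolding 1 2 3 unfolding of_nat_add rk by (simp add: algebra_simps)
qed

text \<open>The bound \<open>N\<close> is independent of \<open>j\<close>, so that all powers share
  one range of \<open>k\<close>; the terms with \<open>k > j\<close> are zero.\<close>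

lemma power_legendre_expansion:
  assumes "j \<le> N"
  shows "[:0, 1:] ^ j =
    (\<Sum>k\<le>N. smult ((2 * real k + 1) * power_legendre_coeff j k) (legendre_poly k))"
  using assms
proof (induction j)
  case 0
  have "power_legendre_coeff 0 0 = 1"
    by (simp add: power_legendre_coeff_def inv_fact_def)
  then show ?case
    by (simp add: sum.atMost_shift power_legendre_coeff_zero legendre_poly_0)
next
  case (Suc j)
  let ?a = power_legendre_coeff and ?P = legendre_poly
  obtain L where N: "N = Suc L"
    using Suc.prems by (cases N) auto
  \<comment> \<open>These remove the upper boundary terms of the two index shifts below; the lower
    ones carry the factor \<open>k = 0\<close>.\<close>
  have z: "?a j N = 0" "?a j (Suc N) = 0"
    using Suc.prems by (simp_all add: power_legendre_coeff_zero)
  have "[:0, 1:] ^ Suc j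
      = (\<Sum>k\<le>N. smult (?a j k) (smult (2 * real k + 1) ([:0, 1:] * ?P k)))"
    using Suc by (simp add: sum_distrib_left mult.commute del: mult_pCons_left)
  also have "\<dots> = (\<Sum>k\<le>N. smult (?a j k * real (k + 1)) (?P (k + 1)))
      + (\<Sum>k\<le>N. smult (?a j k * real k) (?P (k - 1)))"
    unfolding legendre_poly_bonnet by (simp add: smult_add_right sum.distrib)
  also have "(\<Sum>k\<le>N. smult (?a j k * real (k + 1)) (?P (k + 1)))
      = (\<Sum>k\<le>N. smult (real k * ?a j (k - 1)) (?P k))"
    using z unfolding N
    by (subst sum.atMost_Suc, subst sum.atMost_Suc_shift) (simp add: mult.commute)
  also have "(\<Sum>k\<le>N. smult (?a j k * real k) (?P (k - 1)))
      = (\<Sum>k\<le>N. smult (real (k + 1) * ?a j (k + 1)) (?P k))"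
    using z unfolding N
    by (subst sum.atMost_Suc_shift, subst sum.atMost_Suc) (simp add: mult.commute)
  finally show ?case
    unfolding power_legendre_coeff_Suc
    by (simp only: smult_add_left sum.distrib)
qed

lemma smult_sum_right: "smult c (sum f A) = (\<Sum>x\<in>A. smult c (f x))"
  by (induction A rule: infinite_finite_induct) (simp_all add: smult_add_right)

text \<open>Cauchy product of the two factors of \<open>bernoulli_gf\<close>.\<close>

lemma bernoulli_poly_binomial:
  "bernoulli_poly n = (\<Sum>j\<le>n. smult (real (n choose j) * bernoulli_number (n - j)) ([:0, 1:] ^ j))"
proof -
  define b where "b = fps_nth (fps_X / (fps_exp 1 - 1) :: real fps)"
  have expand: "bernoulli_poly m =
      (\<Sum>j\<le>m. smult (fact m / fact j * b (m - j)) ([:0, 1:] ^ j))" for m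
  proof -
    have "bernoulli_poly m =
        smult (fact m) (\<Sum>j=0..m. smult (1 / fact j) ([:0, 1:] ^ j) * [:b (m - j):])"
      unfolding bernoulli_poly_def bernoulli_gf_def
      by (subst mult.commute) (simp add: fps_mult_nth fps_lift_def b_def)
    then show ?thesis
      by (simp add: smult_sum_right atLeast0AtMost mult.commute)
  qed
  \<comment> \<open>At \<open>x = 0\<close> only the summand \<open>j = 0\<close> of
    \<open>expand\<close> survives.\<close>
  have "bernoulli_number m = fact m * b m" for m
    unfolding bernoulli_number_def expand
    by (simp add: poly_sum poly_power sum.atMost_shift)
  then show ?thesis
    unfolding expand by (intro sum.cong) (auto simp: binomial_fact)
qed

theorem theorem1:
  fixes n :: nat
  shows "bernoulli_poly n =
    (\<Sum>k = 0..n.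
       smult
         ((2 ^ (k + 2) * real k + 2 ^ (k + 1)) *
          (\<Sum>j \<in> {j. j \<le> n \<and> even (int j - int k)}.
             fact j * real (n choose j) * fact ((j + k + 2) div 2)
               * inv_fact ((int j - int k) div 2) / fact (j + k + 2)
               * bernoulli_number (n - j)))
         (legendre_poly k))"
proof -
  let ?c = "\<lambda>j k. real (n choose j) * bernoulli_number (n - j)
      * ((2 * real k + 1) * power_legendre_coeff j k)"
  have coeff: "(\<Sum>j\<le>n. ?c j k) = (2 ^ (k + 2) * real k + 2 ^ (k + 1)) *
          (\<Sum>j \<in> {j. j \<le> n \<and> even (int j - int k)}.
             fact j * real (n choose j) * fact ((j + k + 2) div 2)
               * inv_fact ((int j - int k) div 2) / fact (j + k + 2)
               * bernoulli_number (n - j))" for k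
  proof -
    have "(\<Sum>j\<le>n. ?c j k) = (\<Sum>j \<in> {j. j \<le> n \<and> even (int j - int k)}. ?c j k)"
      by (rule sum.mono_neutral_right) (auto simp: power_legendre_coeff_def)
    also have "\<dots> = (2 ^ (k + 2) * real k + 2 ^ (k + 1)) *
          (\<Sum>j \<in> {j. j \<le> n \<and> even (int j - int k)}.
             fact j * real (n choose j) * fact ((j + k + 2) div 2)
               * inv_fact ((int j - int k) div 2) / fact (j + k + 2)
               * bernoulli_number (n - j))"
      unfolding sum_distrib_left
      \<comment> \<open>The prefactor is \<open>(2 * k + 1) * 2 ^ (k + 1)\<close>, whose power of
        two comes from \<open>power_legendre_coeff\<close>.\<close>
      by (intro sum.cong refl) (simp add: power_legendre_coeff_def field_simps del: fact_Suc)
    finally show ?thesis .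
  qed
  \<comment> \<open>Every power is expanded with the same bound \<open>N = n\<close>, so the double
    sum is rectangular and can be swapped.\<close>
  have "bernoulli_poly n = (\<Sum>j\<le>n. \<Sum>k\<le>n. smult (?c j k) (legendre_poly k))"
    by (simp add: bernoulli_poly_binomial [of n] power_legendre_expansion [of _ n] smult_sum_right)
  also have "\<dots> = (\<Sum>k\<le>n. smult (\<Sum>j\<le>n. ?c j k) (legendre_poly k))"
    by (subst sum.swap) (simp add: smult_sum)
  finally show ?thesis
    unfolding coeff by (simp only: atLeast0AtMost)
qed

end
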